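(* Let $(E,\rho,[\cdot,\cdot]_E,L)$ be a local almost-Leibniz algebroid, let $g$ be an $E$-metric and let $\nabla$ be a linear $E$-connection. Then $\nabla$ is $E$-Levi-Civita (with respect to $g$) if and only if it is admissible and $E$-Koszul (with respect to $g$).
   Context: Everything is smooth. $M$ is a manifold, $E\to M$ a real vector bundle of constant rank, $\mathfrak{X}(E)=\Gamma(E)$, $\Omega^1(E)=\Gamma(E^* )$. An anchored vector bundle $(E,\rho)$ has a vector bundle morphism $\rho:E\to T(M)$ over the identity. An almost-Leibniz algebroid $(E,\rho,[\cdot,\cdot]_E)$ is an anchored vector bundle with an $\mathbb{R}$-bilinear bracket on $\mathfrak{X}(E)$ satisfying $[u,fv]_E=\rho(u)(f)v+f[u,v]_E$. It is local with locality operator $L$, a $C^\infty(M,\mathbb{R})$-multilinear map $L:\Omega^1(E)\times\mathfrak{X}(E)\times\mathfrak{X}(E)\to\mathfrak{X}(E)$, if $[fu,v]_E=-\rho(v)(f)u+f[u,v]_E+L(Df,u,v)$, where $(Df)(u):=\rho(u)(f)$. An $E$-metric is a non-degenerate symmetric fiberwise bilinear form on $E$. A linear $E$-connection is an $\mathbb{R}$-bilinear map $\nabla:\mathfrak{X}(E)\times\mathfrak{X}(E)\to\mathfrak{X}(E)$ with $\nabla_u(fv)=\rho(u)(f)v+f\nabla_uv$ and $\nabla_{fu}v=f\nabla_uv$. $(X_a)$ denotes a local frame of $E$, $(e^a)$ the dual coframe, repeated indices are summed; $L(e^a,\nabla_{X_a}u,v)$ does not depend on the frame. $\nabla$ is admissible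 if $[u,v]_E+[v,u]_E=L(e^a,\nabla_{X_a}u,v)+L(e^a,\nabla_{X_a}v,u)$ for all $u,v$. Modified bracket: $[u,v]_E^\nabla:=[u,v]_E-L(e^a,\nabla_{X_a}u,v)$. $E$-torsion: $T(\nabla)(u,v):=\nabla_uv-\nabla_vu-[u,v]_E^\nabla$. $E$-non-metricity: $Q(\nabla,g)(u,v,w):=(\nabla_ug)(v,w)=\rho(u)(g(v,w))-g(\nabla_uv,w)-g(v,\nabla_uw)$. $\nabla$ is $E$-Levi-Civita if $T(\nabla)=0$ and $Q(\nabla,g)=0$. $\nabla$ is $E$-Koszul if for all $u,v,w\in\mathfrak{X}(E)$ $$2g(\nabla_uv,w)=\rho(u)(g(v,w))+\rho(v)(g(u,w))-\rho(w)(g(u,v))-g([v,w]_E^\nabla,u)-g([u,w]_E^\nabla,v)+g([u,v]_E^\nabla,w).$$ *)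

theory Defs
  imports "HOL-Analysis.Analysis"
begin

section \<open>Smooth functions on open subsets of \<open>\<real>\<^sup>n\<close>\<close>

text \<open>
  Points of \<open>\<real>\<^sup>n\<close> are elements of \<^term>\<open>topspace (Euclidean_space n)\<close>, that is, functions
  \<^typ>\<open>nat \<Rightarrow> real\<close> vanishing from index \<open>n\<close> on. Thus the dimension is a natural number, and \<open>0\<close>
  is allowed.
\<close>

definition partial_deriv :: "nat \<Rightarrow> ((nat \<Rightarrow> real) \<Rightarrow> real) \<Rightarrow> (nat \<Rightarrow> real) \<Rightarrow> real" where
  "partial_deriv i f x = deriv (\<lambda>t. f (x(i := t))) (x i)"

text \<open>All iterated partial derivatives exist and are continuous on \<open>W\<close>; meant for \<open>W\<close> open in
  \<^term>\<open>Euclidean_space n\<close>.\<close>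

definition smooth_on :: "nat \<Rightarrow> (nat \<Rightarrow> real) set \<Rightarrow> ((nat \<Rightarrow> real) \<Rightarrow> real) \<Rightarrow> bool" where
  "smooth_on n W f \<longleftrightarrow>
     (\<forall>is \<in> lists {..<n}.
        continuous_on W (foldr partial_deriv is f) \<and>
        (\<forall>i<n. \<forall>x\<in>W.
           (\<lambda>t. foldr partial_deriv is f (x(i := t))) field_differentiable (at (x i))))"


section \<open>Smooth manifolds\<close>

text \<open>
  A manifold is carried by a whole Hausdorff, second countable type \<open>'m\<close>. A chart is a pair
  \<open>(U, \<phi>)\<close>; only the values of \<open>\<phi>\<close> on \<open>U\<close> matter. The atlas need not be maximal.
\<close>

type_synonym 'm chart = "'m set \<times> ('m \<Rightarrow> nat \<Rightarrow> real)"

record 'm manifold =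
  mdim :: nat
  atlas :: "'m chart set"

definition smooth_manifold ::
    "('m :: {t2_space, second_countable_topology}) manifold \<Rightarrow> bool" where
  "smooth_manifold M \<longleftrightarrow>
     (\<forall>(U, \<phi>) \<in> atlas M.
        open U \<and> openin (Euclidean_space (mdim M)) (\<phi> ` U) \<and>
        homeomorphic_map (top_of_set U) (subtopology (Euclidean_space (mdim M)) (\<phi> ` U)) \<phi>) \<and>
     (\<Union>(U, \<phi>) \<in> atlas M. U) = UNIV \<and>
     (\<forall>(U, \<phi>) \<in> atlas M. \<forall>(V, \<psi>) \<in> atlas M. \<forall>i < mdim M.
        smooth_on (mdim M) (\<phi> ` (U \<inter> V)) (\<lambda>x. \<psi> (inv_into U \<phi> x) i))"

definition smooth_near ::
    "('m :: {t2_space, second_countable_topology}) manifold \<Rightarrow> ('m \<Rightarrow> real) \<Rightarrow> 'm \<Rightarrow> bool" where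
  "smooth_near M f p \<longleftrightarrow>
     (\<exists>(U, \<phi>) \<in> atlas M. \<exists>W. open W \<and> p \<in> W \<and> W \<subseteq> U \<and>
        smooth_on (mdim M) (\<phi> ` W) (\<lambda>x. f (inv_into U \<phi> x)))"

definition smooth_functions ::
    "('m :: {t2_space, second_countable_topology}) manifold \<Rightarrow> ('m \<Rightarrow> real) set" where
  "smooth_functions M = {f. \<forall>p. smooth_near M f p}"

text \<open>Tangent vectors at \<open>p\<close> are the derivations at \<open>p\<close> of the algebra of smooth functions. They are
  set to \<open>0\<close> on non-smooth functions, so that each derivation is one element of the HOL type.\<close>

definition tangent_space ::
    "('m :: {t2_space, second_countable_topology}) manifold \<Rightarrow> 'm \<Rightarrow> (('m \<Rightarrow> real) \<Rightarrow> real) set" where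
  "tangent_space M p = {D.
     (\<forall>f \<in> smooth_functions M. \<forall>h \<in> smooth_functions M. D (\<lambda>q. f q + h q) = D f + D h) \<and>
     (\<forall>c. \<forall>f \<in> smooth_functions M. D (\<lambda>q. c * f q) = c * D f) \<and>
     (\<forall>f \<in> smooth_functions M. \<forall>h \<in> smooth_functions M.
        D (\<lambda>q. f q * h q) = f p * D h + h p * D f) \<and>
     (\<forall>f. f \<notin> smooth_functions M \<longrightarrow> D f = 0)}"

text \<open>The coordinate vector \<open>\<partial>/\<partial>x\<^sup>i\<close> at \<open>p\<close> of a chart around \<open>p\<close>.\<close>

definition coord_vector ::
    "('m :: {t2_space, second_countable_topology}) manifold \<Rightarrow> 'm chart \<Rightarrow> nat \<Rightarrow> 'm
       \<Rightarrow> ('m \<Rightarrow> real) \<Rightarrow> real" where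
  "coord_vector M = (\<lambda>(U, \<phi>) i p f.
     if f \<in> smooth_functions M
     then partial_deriv i (\<lambda>x. f (inv_into U \<phi> x)) (\<phi> p) else 0)"


section \<open>Vector bundles of constant rank\<close>

text \<open>
  The fibres are linear subspaces of one real vector space \<open>'v\<close>, which may be of infinite dimension
  (any bundle has this form: take for \<open>'v\<close> the direct sum of its fibres). The smooth
  structure is given by local trivialisations, each written as a frame \<open>(U, X)\<close>: the trivialisation
  over \<open>U\<close> sends \<open>(p, c)\<close> to \<open>\<Sum>a<r. c a *\<^sub>R X a p\<close>.
\<close>

record ('m, 'v) vbundle =
  brank :: nat
  fibre :: "'m \<Rightarrow> 'v set"
  trivs :: "('m set \<times> (nat \<Rightarrow> 'm \<Rightarrow> 'v)) set"

definition basis_family :: "nat \<Rightarrow> (nat \<Rightarrow> 'v::real_vector) \<Rightarrow> 'v set \<Rightarrow> bool" where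
  "basis_family r b S \<longleftrightarrow> inj_on b {..<r} \<and> independent (b ` {..<r}) \<and> span (b ` {..<r}) = S"

text \<open>The coordinate of \<open>y\<close> at \<open>b a\<close> with respect to the basis \<open>b 0, \<dots>, b (r - 1)\<close>.\<close>

definition basis_coord :: "nat \<Rightarrow> (nat \<Rightarrow> 'v::real_vector) \<Rightarrow> nat \<Rightarrow> 'v \<Rightarrow> real" where
  "basis_coord r b a y = representation (b ` {..<r}) y (b a)"

definition vector_bundle ::
    "('m :: {t2_space, second_countable_topology}) manifold \<Rightarrow> ('m, 'v::real_vector) vbundle \<Rightarrow> bool"
  where
  "vector_bundle M E \<longleftrightarrow>
     (\<forall>p. subspace (fibre E p)) \<and>
     (\<forall>(U, X) \<in> trivs E. open U \<and> (\<forall>p\<in>U. basis_family (brank E) (\<lambda>a. X a p) (fibre E p))) \<and>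
     (\<Union>(U, X) \<in> trivs E. U) = UNIV \<and>
     (\<forall>(U, X) \<in> trivs E. \<forall>(V, Y) \<in> trivs E. \<forall>a < brank E. \<forall>b < brank E. \<forall>p \<in> U \<inter> V.
        smooth_near M (\<lambda>q. basis_coord (brank E) (\<lambda>c. X c q) a (Y b q)) p)"

definition sections ::
    "('m :: {t2_space, second_countable_topology}) manifold \<Rightarrow> ('m, 'v::real_vector) vbundle
       \<Rightarrow> ('m \<Rightarrow> 'v) set" where
  "sections M E = {u.
     (\<forall>p. u p \<in> fibre E p) \<and>
     (\<forall>p. \<exists>(U, X) \<in> trivs E. p \<in> U \<and>
        (\<forall>a < brank E. smooth_near M (\<lambda>q. basis_coord (brank E) (\<lambda>c. X c q) a (u q)) p))}"

definition linear_fibre_map :: "'v::real_vector set \<Rightarrow> ('v \<Rightarrow> real) \<Rightarrow> bool" where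
  "linear_fibre_map S \<alpha> \<longleftrightarrow>
     (\<forall>x\<in>S. \<forall>y\<in>S. \<alpha> (x + y) = \<alpha> x + \<alpha> y) \<and> (\<forall>c. \<forall>x\<in>S. \<alpha> (c *\<^sub>R x) = c * \<alpha> x)"

text \<open>The sections of the dual bundle. A covector at \<open>p\<close> is a linear form on the fibre at \<open>p\<close>,
  set to \<open>0\<close> off the fibre, so that each covector is one element of the HOL type.\<close>

definition one_forms ::
    "('m :: {t2_space, second_countable_topology}) manifold \<Rightarrow> ('m, 'v::real_vector) vbundle
       \<Rightarrow> ('m \<Rightarrow> 'v \<Rightarrow> real) set" where
  "one_forms M E = {\<omega>.
     (\<forall>p. linear_fibre_map (fibre E p) (\<omega> p) \<and> (\<forall>x. x \<notin> fibre E p \<longrightarrow> \<omega> p x = 0)) \<and>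
     (\<forall>p. \<exists>(U, X) \<in> trivs E. p \<in> U \<and>
        (\<forall>a < brank E. smooth_near M (\<lambda>q. \<omega> q (X a q)) p))}"


section \<open>Local almost-Leibniz algebroids\<close>

text \<open>A morphism \<open>E \<rightarrow> T(M)\<close> over the identity: fibrewise linear, and with smooth coefficients
  with respect to local frames of \<open>E\<close> and coordinate frames of \<open>T(M)\<close>.\<close>

definition anchored_vector_bundle ::
    "('m :: {t2_space, second_countable_topology}) manifold \<Rightarrow> ('m, 'v::real_vector) vbundle
       \<Rightarrow> ('m \<Rightarrow> 'v \<Rightarrow> ('m \<Rightarrow> real) \<Rightarrow> real) \<Rightarrow> bool" where
  "anchored_vector_bundle M E \<rho> \<longleftrightarrow>
     vector_bundle M E \<and>
     (\<forall>p. \<forall>x \<in> fibre E p. \<rho> p x \<in> tangent_space M p) \<and>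
     (\<forall>p f. linear_fibre_map (fibre E p) (\<lambda>x. \<rho> p x f)) \<and>
     (\<forall>p. \<exists>(U, X) \<in> trivs E. \<exists>(V, \<phi>) \<in> atlas M. \<exists>W c.
        open W \<and> p \<in> W \<and> W \<subseteq> U \<inter> V \<and>
        (\<forall>a < brank E. \<forall>i < mdim M. smooth_near M (c a i) p) \<and>
        (\<forall>q \<in> W. \<forall>a < brank E.
           \<rho> q (X a q) = (\<lambda>f. \<Sum>i < mdim M. c a i q * coord_vector M (V, \<phi>) i q f)))"

definition anchor_act ::
    "('m \<Rightarrow> 'v \<Rightarrow> ('m \<Rightarrow> real) \<Rightarrow> real) \<Rightarrow> ('m \<Rightarrow> 'v) \<Rightarrow> ('m \<Rightarrow> real) \<Rightarrow> 'm \<Rightarrow> real" where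
  "anchor_act \<rho> u f = (\<lambda>p. \<rho> p (u p) f)"

text \<open>The 1-form \<open>Df\<close> with \<open>(Df)(u) = \<rho>(u)(f)\<close>.\<close>

definition anchor_diff ::
    "('m, 'v) vbundle \<Rightarrow> ('m \<Rightarrow> 'v \<Rightarrow> ('m \<Rightarrow> real) \<Rightarrow> real) \<Rightarrow> ('m \<Rightarrow> real) \<Rightarrow> 'm \<Rightarrow> 'v \<Rightarrow> real" where
  "anchor_diff E \<rho> f = (\<lambda>p x. if x \<in> fibre E p then \<rho> p x f else 0)"

definition real_bilinear_on_sections ::
    "('m :: {t2_space, second_countable_topology}) manifold \<Rightarrow> ('m, 'v::real_vector) vbundle
       \<Rightarrow> (('m \<Rightarrow> 'v) \<Rightarrow> ('m \<Rightarrow> 'v) \<Rightarrow> 'm \<Rightarrow> 'v) \<Rightarrow> bool" where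
  "real_bilinear_on_sections M E B \<longleftrightarrow>
     (\<forall>u \<in> sections M E. \<forall>v \<in> sections M E. B u v \<in> sections M E) \<and>
     (\<forall>u \<in> sections M E. \<forall>u' \<in> sections M E. \<forall>v \<in> sections M E.
        B (\<lambda>p. u p + u' p) v = (\<lambda>p. B u v p + B u' v p)) \<and>
     (\<forall>u \<in> sections M E. \<forall>v \<in> sections M E. \<forall>v' \<in> sections M E.
        B u (\<lambda>p. v p + v' p) = (\<lambda>p. B u v p + B u v' p)) \<and>
     (\<forall>c. \<forall>u \<in> sections M E. \<forall>v \<in> sections M E.
        B (\<lambda>p. c *\<^sub>R u p) v = (\<lambda>p. c *\<^sub>R B u v p) \<and>
        B u (\<lambda>p. c *\<^sub>R v p) = (\<lambda>p. c *\<^sub>R B u v p))"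

definition almost_Leibniz_algebroid ::
    "('m :: {t2_space, second_countable_topology}) manifold \<Rightarrow> ('m, 'v::real_vector) vbundle
       \<Rightarrow> ('m \<Rightarrow> 'v \<Rightarrow> ('m \<Rightarrow> real) \<Rightarrow> real)
       \<Rightarrow> (('m \<Rightarrow> 'v) \<Rightarrow> ('m \<Rightarrow> 'v) \<Rightarrow> 'm \<Rightarrow> 'v) \<Rightarrow> bool" where
  "almost_Leibniz_algebroid M E \<rho> br \<longleftrightarrow>
     anchored_vector_bundle M E \<rho> \<and>
     real_bilinear_on_sections M E br \<and>
     (\<forall>u \<in> sections M E. \<forall>v \<in> sections M E. \<forall>f \<in> smooth_functions M.
        br u (\<lambda>p. f p *\<^sub>R v p) = (\<lambda>p. anchor_act \<rho> u f p *\<^sub>R v p + f p *\<^sub>R br u v p))"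

definition smooth_multilinear ::
    "('m :: {t2_space, second_countable_topology}) manifold \<Rightarrow> ('m, 'v::real_vector) vbundle
       \<Rightarrow> (('m \<Rightarrow> 'v \<Rightarrow> real) \<Rightarrow> ('m \<Rightarrow> 'v) \<Rightarrow> ('m \<Rightarrow> 'v) \<Rightarrow> 'm \<Rightarrow> 'v) \<Rightarrow> bool" where
  "smooth_multilinear M E L \<longleftrightarrow>
     (\<forall>\<omega> \<in> one_forms M E. \<forall>u \<in> sections M E. \<forall>v \<in> sections M E. L \<omega> u v \<in> sections M E) \<and>
     (\<forall>\<omega> \<in> one_forms M E. \<forall>\<omega>' \<in> one_forms M E. \<forall>u \<in> sections M E. \<forall>v \<in> sections M E.
        L (\<lambda>p x. \<omega> p x + \<omega>' p x) u v = (\<lambda>p. L \<omega> u v p + L \<omega>' u v p)) \<and>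
     (\<forall>\<omega> \<in> one_forms M E. \<forall>u \<in> sections M E. \<forall>u' \<in> sections M E. \<forall>v \<in> sections M E.
        L \<omega> (\<lambda>p. u p + u' p) v = (\<lambda>p. L \<omega> u v p + L \<omega> u' v p)) \<and>
     (\<forall>\<omega> \<in> one_forms M E. \<forall>u \<in> sections M E. \<forall>v \<in> sections M E. \<forall>v' \<in> sections M E.
        L \<omega> u (\<lambda>p. v p + v' p) = (\<lambda>p. L \<omega> u v p + L \<omega> u v' p)) \<and>
     (\<forall>f \<in> smooth_functions M. \<forall>\<omega> \<in> one_forms M E. \<forall>u \<in> sections M E. \<forall>v \<in> sections M E.
        L (\<lambda>p x. f p * \<omega> p x) u v = (\<lambda>p. f p *\<^sub>R L \<omega> u v p) \<and>
        L \<omega> (\<lambda>p. f p *\<^sub>R u p) v = (\<lambda>p. f p *\<^sub>R L \<omega> u v p) \<and>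
        L \<omega> u (\<lambda>p. f p *\<^sub>R v p) = (\<lambda>p. f p *\<^sub>R L \<omega> u v p))"

definition local_almost_Leibniz_algebroid ::
    "('m :: {t2_space, second_countable_topology}) manifold \<Rightarrow> ('m, 'v::real_vector) vbundle
       \<Rightarrow> ('m \<Rightarrow> 'v \<Rightarrow> ('m \<Rightarrow> real) \<Rightarrow> real)
       \<Rightarrow> (('m \<Rightarrow> 'v) \<Rightarrow> ('m \<Rightarrow> 'v) \<Rightarrow> 'm \<Rightarrow> 'v)
       \<Rightarrow> (('m \<Rightarrow> 'v \<Rightarrow> real) \<Rightarrow> ('m \<Rightarrow> 'v) \<Rightarrow> ('m \<Rightarrow> 'v) \<Rightarrow> 'm \<Rightarrow> 'v) \<Rightarrow> bool" where
  "local_almost_Leibniz_algebroid M E \<rho> br L \<longleftrightarrow>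
     almost_Leibniz_algebroid M E \<rho> br \<and>
     smooth_multilinear M E L \<and>
     (\<forall>u \<in> sections M E. \<forall>v \<in> sections M E. \<forall>f \<in> smooth_functions M.
        br (\<lambda>p. f p *\<^sub>R u p) v =
          (\<lambda>p. - (anchor_act \<rho> v f p *\<^sub>R u p) + f p *\<^sub>R br u v p + L (anchor_diff E \<rho> f) u v p))"


section \<open>Metrics and connections\<close>

definition E_metric ::
    "('m :: {t2_space, second_countable_topology}) manifold \<Rightarrow> ('m, 'v::real_vector) vbundle
       \<Rightarrow> ('m \<Rightarrow> 'v \<Rightarrow> 'v \<Rightarrow> real) \<Rightarrow> bool" where
  "E_metric M E g \<longleftrightarrow>
     (\<forall>p. \<forall>x \<in> fibre E p. linear_fibre_map (fibre E p) (g p x)) \<and>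
     (\<forall>p. \<forall>x \<in> fibre E p. \<forall>y \<in> fibre E p. g p x y = g p y x) \<and>
     (\<forall>p. \<forall>x \<in> fibre E p. (\<forall>y \<in> fibre E p. g p x y = 0) \<longrightarrow> x = 0) \<and>
     (\<forall>p. \<exists>(U, X) \<in> trivs E. p \<in> U \<and>
        (\<forall>a < brank E. \<forall>b < brank E. smooth_near M (\<lambda>q. g q (X a q) (X b q)) p))"

definition linear_E_connection ::
    "('m :: {t2_space, second_countable_topology}) manifold \<Rightarrow> ('m, 'v::real_vector) vbundle
       \<Rightarrow> ('m \<Rightarrow> 'v \<Rightarrow> ('m \<Rightarrow> real) \<Rightarrow> real)
       \<Rightarrow> (('m \<Rightarrow> 'v) \<Rightarrow> ('m \<Rightarrow> 'v) \<Rightarrow> 'm \<Rightarrow> 'v) \<Rightarrow> bool" where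
  "linear_E_connection M E \<rho> nabla \<longleftrightarrow>
     real_bilinear_on_sections M E nabla \<and>
     (\<forall>u \<in> sections M E. \<forall>v \<in> sections M E. \<forall>f \<in> smooth_functions M.
        nabla u (\<lambda>p. f p *\<^sub>R v p) = (\<lambda>p. anchor_act \<rho> u f p *\<^sub>R v p + f p *\<^sub>R nabla u v p) \<and>
        nabla (\<lambda>p. f p *\<^sub>R u p) v = (\<lambda>p. f p *\<^sub>R nabla u v p))"

text \<open>
  Global sections \<open>X a\<close> and global 1-forms \<open>e a\<close> which restrict to a local frame and its dual
  coframe on a neighbourhood of \<open>p\<close>. Multiplying by bump functions shows that every local frame
  around \<open>p\<close>, with its dual coframe, agrees near \<open>p\<close> with such a pair.
\<close>

definition frame_near ::
    "('m :: {t2_space, second_countable_topology}) manifold \<Rightarrow> ('m, 'v::real_vector) vbundle \<Rightarrow> 'm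
       \<Rightarrow> (nat \<Rightarrow> 'm \<Rightarrow> 'v) \<Rightarrow> (nat \<Rightarrow> 'm \<Rightarrow> 'v \<Rightarrow> real) \<Rightarrow> bool" where
  "frame_near M E p X e \<longleftrightarrow>
     (\<forall>a < brank E. X a \<in> sections M E \<and> e a \<in> one_forms M E) \<and>
     (\<exists>W. open W \<and> p \<in> W \<and>
        (\<forall>q \<in> W. basis_family (brank E) (\<lambda>a. X a q) (fibre E q) \<and>
           (\<forall>a < brank E. \<forall>b < brank E. e a q (X b q) = (if a = b then 1 else 0))))"

text \<open>
  The section \<open>L(e\<^sup>a, \<nabla>\<^bsub>X\<^sub>a\<^esub>u, v)\<close>. The maps \<open>L\<close> and \<open>\<nabla>\<close> are defined on global sections only; being
  tensorial in \<open>e\<^sup>a\<close> and \<open>X\<^sub>a\<close>, the expression is evaluated at \<open>p\<close> on global extensions of a local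
  frame around \<open>p\<close>. Its value does not depend on the frame and extensions picked by \<open>SOME\<close>.
\<close>

definition locality_trace ::
    "('m :: {t2_space, second_countable_topology}) manifold \<Rightarrow> ('m, 'v::real_vector) vbundle
       \<Rightarrow> (('m \<Rightarrow> 'v \<Rightarrow> real) \<Rightarrow> ('m \<Rightarrow> 'v) \<Rightarrow> ('m \<Rightarrow> 'v) \<Rightarrow> 'm \<Rightarrow> 'v)
       \<Rightarrow> (('m \<Rightarrow> 'v) \<Rightarrow> ('m \<Rightarrow> 'v) \<Rightarrow> 'm \<Rightarrow> 'v)
       \<Rightarrow> ('m \<Rightarrow> 'v) \<Rightarrow> ('m \<Rightarrow> 'v) \<Rightarrow> 'm \<Rightarrow> 'v" where
  "locality_trace M E L nabla u v = (\<lambda>p.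
     let (X, e) = (SOME (X, e). frame_near M E p X e)
     in \<Sum>a < brank E. L (e a) (nabla (X a) u) v p)"

definition admissible ::
    "('m :: {t2_space, second_countable_topology}) manifold \<Rightarrow> ('m, 'v::real_vector) vbundle
       \<Rightarrow> (('m \<Rightarrow> 'v) \<Rightarrow> ('m \<Rightarrow> 'v) \<Rightarrow> 'm \<Rightarrow> 'v)
       \<Rightarrow> (('m \<Rightarrow> 'v \<Rightarrow> real) \<Rightarrow> ('m \<Rightarrow> 'v) \<Rightarrow> ('m \<Rightarrow> 'v) \<Rightarrow> 'm \<Rightarrow> 'v)
       \<Rightarrow> (('m \<Rightarrow> 'v) \<Rightarrow> ('m \<Rightarrow> 'v) \<Rightarrow> 'm \<Rightarrow> 'v) \<Rightarrow> bool" where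
  "admissible M E br L nabla \<longleftrightarrow>
     (\<forall>u \<in> sections M E. \<forall>v \<in> sections M E. \<forall>p.
        br u v p + br v u p =
          locality_trace M E L nabla u v p + locality_trace M E L nabla v u p)"

definition modified_bracket ::
    "('m :: {t2_space, second_countable_topology}) manifold \<Rightarrow> ('m, 'v::real_vector) vbundle
       \<Rightarrow> (('m \<Rightarrow> 'v) \<Rightarrow> ('m \<Rightarrow> 'v) \<Rightarrow> 'm \<Rightarrow> 'v)
       \<Rightarrow> (('m \<Rightarrow> 'v \<Rightarrow> real) \<Rightarrow> ('m \<Rightarrow> 'v) \<Rightarrow> ('m \<Rightarrow> 'v) \<Rightarrow> 'm \<Rightarrow> 'v)
       \<Rightarrow> (('m \<Rightarrow> 'v) \<Rightarrow> ('m \<Rightarrow> 'v) \<Rightarrow> 'm \<Rightarrow> 'v)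
       \<Rightarrow> ('m \<Rightarrow> 'v) \<Rightarrow> ('m \<Rightarrow> 'v) \<Rightarrow> 'm \<Rightarrow> 'v" where
  "modified_bracket M E br L nabla u v = (\<lambda>p. br u v p - locality_trace M E L nabla u v p)"

definition E_torsion ::
    "('m :: {t2_space, second_countable_topology}) manifold \<Rightarrow> ('m, 'v::real_vector) vbundle
       \<Rightarrow> (('m \<Rightarrow> 'v) \<Rightarrow> ('m \<Rightarrow> 'v) \<Rightarrow> 'm \<Rightarrow> 'v)
       \<Rightarrow> (('m \<Rightarrow> 'v \<Rightarrow> real) \<Rightarrow> ('m \<Rightarrow> 'v) \<Rightarrow> ('m \<Rightarrow> 'v) \<Rightarrow> 'm \<Rightarrow> 'v)
       \<Rightarrow> (('m \<Rightarrow> 'v) \<Rightarrow> ('m \<Rightarrow> 'v) \<Rightarrow> 'm \<Rightarrow> 'v)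
       \<Rightarrow> ('m \<Rightarrow> 'v) \<Rightarrow> ('m \<Rightarrow> 'v) \<Rightarrow> 'm \<Rightarrow> 'v" where
  "E_torsion M E br L nabla u v =
     (\<lambda>p. nabla u v p - nabla v u p - modified_bracket M E br L nabla u v p)"

definition E_nonmetricity ::
    "('m \<Rightarrow> 'v \<Rightarrow> ('m \<Rightarrow> real) \<Rightarrow> real)
       \<Rightarrow> (('m \<Rightarrow> 'v) \<Rightarrow> ('m \<Rightarrow> 'v) \<Rightarrow> 'm \<Rightarrow> 'v)
       \<Rightarrow> ('m \<Rightarrow> 'v \<Rightarrow> 'v \<Rightarrow> real)
       \<Rightarrow> ('m \<Rightarrow> 'v) \<Rightarrow> ('m \<Rightarrow> 'v) \<Rightarrow> ('m \<Rightarrow> 'v) \<Rightarrow> 'm \<Rightarrow> real" where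
  "E_nonmetricity \<rho> nabla g u v w =
     (\<lambda>p. anchor_act \<rho> u (\<lambda>q. g q (v q) (w q)) p
            - g p (nabla u v p) (w p) - g p (v p) (nabla u w p))"

definition E_Levi_Civita ::
    "('m :: {t2_space, second_countable_topology}) manifold \<Rightarrow> ('m, 'v::real_vector) vbundle
       \<Rightarrow> ('m \<Rightarrow> 'v \<Rightarrow> ('m \<Rightarrow> real) \<Rightarrow> real)
       \<Rightarrow> (('m \<Rightarrow> 'v) \<Rightarrow> ('m \<Rightarrow> 'v) \<Rightarrow> 'm \<Rightarrow> 'v)
       \<Rightarrow> (('m \<Rightarrow> 'v \<Rightarrow> real) \<Rightarrow> ('m \<Rightarrow> 'v) \<Rightarrow> ('m \<Rightarrow> 'v) \<Rightarrow> 'm \<Rightarrow> 'v)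
       \<Rightarrow> ('m \<Rightarrow> 'v \<Rightarrow> 'v \<Rightarrow> real)
       \<Rightarrow> (('m \<Rightarrow> 'v) \<Rightarrow> ('m \<Rightarrow> 'v) \<Rightarrow> 'm \<Rightarrow> 'v) \<Rightarrow> bool" where
  "E_Levi_Civita M E \<rho> br L g nabla \<longleftrightarrow>
     (\<forall>u \<in> sections M E. \<forall>v \<in> sections M E. E_torsion M E br L nabla u v = (\<lambda>p. 0)) \<and>
     (\<forall>u \<in> sections M E. \<forall>v \<in> sections M E. \<forall>w \<in> sections M E.
        E_nonmetricity \<rho> nabla g u v w = (\<lambda>p. 0))"

definition E_Koszul ::
    "('m :: {t2_space, second_countable_topology}) manifold \<Rightarrow> ('m, 'v::real_vector) vbundle
       \<Rightarrow> ('m \<Rightarrow> 'v \<Rightarrow> ('m \<Rightarrow> real) \<Rightarrow> real)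
       \<Rightarrow> (('m \<Rightarrow> 'v) \<Rightarrow> ('m \<Rightarrow> 'v) \<Rightarrow> 'm \<Rightarrow> 'v)
       \<Rightarrow> (('m \<Rightarrow> 'v \<Rightarrow> real) \<Rightarrow> ('m \<Rightarrow> 'v) \<Rightarrow> ('m \<Rightarrow> 'v) \<Rightarrow> 'm \<Rightarrow> 'v)
       \<Rightarrow> ('m \<Rightarrow> 'v \<Rightarrow> 'v \<Rightarrow> real)
       \<Rightarrow> (('m \<Rightarrow> 'v) \<Rightarrow> ('m \<Rightarrow> 'v) \<Rightarrow> 'm \<Rightarrow> 'v) \<Rightarrow> bool" where
  "E_Koszul M E \<rho> br L g nabla \<longleftrightarrow>
     (\<forall>u \<in> sections M E. \<forall>v \<in> sections M E. \<forall>w \<in> sections M E. \<forall>p.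
        2 * g p (nabla u v p) (w p) =
            anchor_act \<rho> u (\<lambda>q. g q (v q) (w q)) p
          + anchor_act \<rho> v (\<lambda>q. g q (u q) (w q)) p
          - anchor_act \<rho> w (\<lambda>q. g q (u q) (v q)) p
          - g p (modified_bracket M E br L nabla v w p) (u p)
          - g p (modified_bracket M E br L nabla u w p) (v p)
          + g p (modified_bracket M E br L nabla u v p) (w p))"

end

theory Submission
  imports Defs
begin

text \<open>
  Both implications are the classical Koszul computation. In the converse one, the bracket terms
  cancel by antisymmetry of the modified bracket (admissibility) and bilinearity of \<open>g\<close>, which is
  only available on the fibres of \<open>E\<close>; so the trace \<open>L(e\<^sup>a, \<nabla>\<^bsub>X\<^sub>a\<^esub>u, v)\<close> must be known to take values
  in \<open>E\<close>. As \<open>L\<close> and \<open>\<nabla>\<close> act on global sections, this requires extending local frames and coframes to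
  global ones by bump functions, which also yield a section through every vector of \<open>E\<close>, as needed
  to apply non-degeneracy of \<open>g\<close>.
\<close>

section \<open>Bump functions\<close>

text \<open>The case \<open>k = 0\<close> is the classical flat function; the powers of
  \<open>inverse x\<close> are the factors that differentiating it produces.\<close>

definition flat_exp :: "nat \<Rightarrow> real \<Rightarrow> real" where
  "flat_exp k x = (if x > 0 then exp (- inverse x) * inverse x ^ k else 0)"

text \<open>Only the origin is delicate: there the difference quotient tends to 0, because the
  exponential beats every power of \<open>inverse x\<close>, and the stated derivative is 0 as
  well.\<close>

lemma flat_exp_has_derivative:
  "(flat_exp k has_real_derivative flat_exp (k + 2) x - k * flat_exp (k + 1) x) (at x)"
proof -
  consider "x > 0" | "x < 0" | "x = 0" by linarith
  then show ?thesis
  proof cases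
    case 1
    have "((\<lambda>x. exp (- inverse x) * inverse x ^ k) has_real_derivative
        flat_exp (k + 2) x - k * flat_exp (k + 1) x) (at x)"
    proof -
      \<comment> \<open>The power rule yields the truncated exponent \<open>k - Suc 0\<close>; at
        \<open>k = 0\<close> the factor \<open>k\<close> makes both sides vanish.\<close>
      have "real k * (inverse x ^ (k - Suc 0) * (inverse x * inverse x)) = k * (inverse x ^ k * inverse x)"
        by (cases k) auto
      then show ?thesis
        using 1 by (auto intro!: derivative_eq_intros simp: flat_exp_def power2_eq_square algebra_simps)
    qed
    then show ?thesis
      by (rule has_field_derivative_transform_within_open[where S = "{0<..}"])
        (use 1 in \<open>auto simp: flat_exp_def\<close>)
  next
    case 2
    have "((\<lambda>_. 0) has_real_derivative 0) (at x)" by simp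
    then have "(flat_exp k has_real_derivative 0) (at x)"
      by (rule has_field_derivative_transform_within_open[where S = "{..<0}"])
        (use 2 in \<open>auto simp: flat_exp_def\<close>)
    then show ?thesis using 2 by (simp add: flat_exp_def)
  next
    case 3
    \<comment> \<open>In the variable \<open>inverse y\<close>, which tends to infinity, this is the
      decay of a power divided by \<open>exp\<close>.\<close>
    have "((\<lambda>y. inverse y ^ Suc k / exp (inverse y)) \<longlongrightarrow> 0) (at_right (0::real))"
      by (rule filterlim_compose[OF tendsto_power_div_exp_0 filterlim_inverse_at_top_right])
    then have r: "((\<lambda>y. flat_exp k y / y) \<longlongrightarrow> 0) (at_right 0)"
      by (rule Lim_transform_eventually)
        (auto simp: eventually_at_filter flat_exp_def exp_minus field_simps)
    have l: "((\<lambda>y. flat_exp k y / y) \<longlongrightarrow> 0) (at_left 0)"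
      by (rule Lim_transform_eventually[OF tendsto_const])
        (auto simp: eventually_at_filter flat_exp_def)
    have "((\<lambda>y. flat_exp k y / y) \<longlongrightarrow> 0) (at 0)"
      using l r by (simp add: filterlim_split_at)
    then show ?thesis using 3 by (simp add: has_field_derivative_iff flat_exp_def)
  qed
qed

lemma flat_exp_mono: "x \<le> y \<Longrightarrow> flat_exp 0 x \<le> flat_exp 0 y"
  by (auto simp: flat_exp_def)

text \<open>Since the derivative of \<^term>\<open>flat_exp k\<close> is a combination of \<^term>\<open>flat_exp (k + 1)\<close> and
  \<^term>\<open>flat_exp (k + 2)\<close>, this class is closed under partial derivatives, so its members are smooth
  without any general chain or product rule for higher derivatives.\<close>

inductive_set smooth_terms :: "((nat \<Rightarrow> real) \<Rightarrow> real) set" where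
  const: "(\<lambda>_. c) \<in> smooth_terms"
| coord: "(\<lambda>x. x i) \<in> smooth_terms"
| add: "f \<in> smooth_terms \<Longrightarrow> h \<in> smooth_terms \<Longrightarrow> (\<lambda>x. f x + h x) \<in> smooth_terms"
| mult: "f \<in> smooth_terms \<Longrightarrow> h \<in> smooth_terms \<Longrightarrow> (\<lambda>x. f x * h x) \<in> smooth_terms"
| flat: "f \<in> smooth_terms \<Longrightarrow> (\<lambda>x. flat_exp k (f x)) \<in> smooth_terms"

lemma smooth_terms_continuous: "f \<in> smooth_terms \<Longrightarrow> continuous_on UNIV f"
proof (induction rule: smooth_terms.induct)
  case (flat f k)
  have "continuous_on UNIV (flat_exp k)"
    using flat_exp_has_derivative by (meson DERIV_isCont continuous_at_imp_continuous_on)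
  then show ?case using flat.IH continuous_on_compose2 by blast
qed (auto intro!: continuous_intros)

lemma smooth_terms_partial_deriv:
  assumes "f \<in> smooth_terms"
  shows "\<exists>f' \<in> smooth_terms. \<forall>x. ((\<lambda>t. f (x(i := t))) has_real_derivative f' x) (at (x i))"
  using assms
proof (induction rule: smooth_terms.induct)
  case (const c)
  show ?case by (rule bexI[of _ "\<lambda>_. 0"]) (auto intro: smooth_terms.const)
next
  case (coord j)
  show ?case
    by (rule bexI[of _ "\<lambda>_. if j = i then 1 else 0"]) (auto intro: smooth_terms.const)
next
  case (add f h)
  then obtain f' h' where 1: "f' \<in> smooth_terms" "h' \<in> smooth_terms"
    and 2: "\<And>x. ((\<lambda>t. f (x(i := t))) has_real_derivative f' x) (at (x i))"
      "\<And>x. ((\<lambda>t. h (x(i := t))) has_real_derivative h' x) (at (x i))" by blast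
  show ?case
    by (rule bexI[of _ "\<lambda>x. f' x + h' x"], intro allI DERIV_add 2) (intro smooth_terms.add 1)
next
  case (mult f h)
  then obtain f' h' where 1: "f' \<in> smooth_terms" "h' \<in> smooth_terms"
    and 2: "\<And>x. ((\<lambda>t. f (x(i := t))) has_real_derivative f' x) (at (x i))"
      "\<And>x. ((\<lambda>t. h (x(i := t))) has_real_derivative h' x) (at (x i))" by blast
  show ?case
  proof (rule bexI[of _ "\<lambda>x. f' x * h x + h' x * f x"])
    show "\<forall>x. ((\<lambda>t. f (x(i := t)) * h (x(i := t))) has_real_derivative f' x * h x + h' x * f x) (at (x i))"
    proof
      fix x
      show "((\<lambda>t. f (x(i := t)) * h (x(i := t))) has_real_derivative f' x * h x + h' x * f x) (at (x i))"
        using DERIV_mult[OF 2(1)[of x] 2(2)[of x]] by simp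
    qed
  qed (use 1 mult.hyps in \<open>auto intro!: smooth_terms.add smooth_terms.mult\<close>)
next
  case (flat f k)
  then obtain f' where 1: "f' \<in> smooth_terms"
    and 2: "\<And>x. ((\<lambda>t. f (x(i := t))) has_real_derivative f' x) (at (x i))" by blast
  \<comment> \<open>The difference is written as a sum with the constant \<open>- real k\<close>, to
    fit the constructors of \<open>smooth_terms\<close>.\<close>
  let ?d = "\<lambda>x. (flat_exp (k + 2) (f x) + (- real k) * flat_exp (k + 1) (f x)) * f' x"
  show ?case
  proof (rule bexI[of _ ?d])
    show "\<forall>x. ((\<lambda>t. flat_exp k (f (x(i := t)))) has_real_derivative ?d x) (at (x i))"
    proof
      fix x
      show "((\<lambda>t. flat_exp k (f (x(i := t)))) has_real_derivative ?d x) (at (x i))"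
        using DERIV_chain2[where f = "flat_exp k" and g = "\<lambda>t. f (x(i := t))" and x = "x i",
            OF flat_exp_has_derivative 2] by simp
    qed
    show "?d \<in> smooth_terms"
      by (intro smooth_terms.intros flat.hyps 1)
  qed
qed

lemma smooth_terms_smooth_on: "f \<in> smooth_terms \<Longrightarrow> smooth_on n W f"
proof -
  assume f: "f \<in> smooth_terms"
  have pd: "partial_deriv i h \<in> smooth_terms" if h: "h \<in> smooth_terms" for i h
  proof -
    obtain h' where "h' \<in> smooth_terms"
      "\<And>x. ((\<lambda>t. h (x(i := t))) has_real_derivative h' x) (at (x i))"
      using smooth_terms_partial_deriv[OF h] by blast
    then have "partial_deriv i h = h'"
      by (auto simp: partial_deriv_def DERIV_imp_deriv)
    with \<open>h' \<in> _\<close> show ?thesis by simp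
  qed
  have *: "foldr partial_deriv is f \<in> smooth_terms" for "is"
    by (induction "is") (auto intro: pd f)
  show ?thesis
    unfolding smooth_on_def
  proof (intro ballI conjI allI impI)
    fix "is" :: "nat list" and i :: nat and x :: "nat \<Rightarrow> real"
    show "continuous_on W (foldr partial_deriv is f)"
      using smooth_terms_continuous[OF *] by (rule continuous_on_subset) simp
    show "(\<lambda>t. foldr partial_deriv is f (x(i := t))) field_differentiable at (x i)"
      using smooth_terms_partial_deriv[OF *, of "is" i] by (auto simp: field_differentiable_def)
  qed
qed

section \<open>Locality of smoothness in Euclidean space\<close>

lemma smooth_on_subset: "smooth_on n W f \<Longrightarrow> V \<subseteq> W \<Longrightarrow> smooth_on n V f"
  unfolding smooth_on_def by (meson continuous_on_subset subsetD)

lemma Euclidean_space_eq_top_of_set: "Euclidean_space n = top_of_set {x. \<forall>i\<ge>n. x i = 0}"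
  by (simp add: Euclidean_space_def euclidean_product_topology)

text \<open>Partial derivatives see a function only along coordinate lines. Near \<open>x\<close>
  such a line stays in \<open>W\<close>: \<open>i < n\<close> keeps it in the Euclidean subspace and
  openness does the rest.\<close>

lemma eventually_fun_upd_in_openin:
  assumes "openin (Euclidean_space n) W" "x \<in> W" "i < n"
  shows "eventually (\<lambda>t. x(i := t) \<in> W) (nhds (x i))"
proof -
  obtain T where T: "open T" "W = {x. \<forall>i\<ge>n. x i = 0} \<inter> T"
    using assms(1) by (auto simp: Euclidean_space_eq_top_of_set openin_open)
  have "continuous_on UNIV (\<lambda>t. x(i := t))"
  proof (rule continuous_on_coordinatewise_then_product)
    show "continuous_on UNIV (\<lambda>t. (x(i := t)) j)" for j
      by (cases "j = i") auto
  qed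
  then have "open ((\<lambda>t. x(i := t)) -` T)"
    by (simp add: T(1) continuous_on_open_vimage)
  then have "eventually (\<lambda>t. t \<in> (\<lambda>t. x(i := t)) -` T) (nhds (x i))"
    using assms(2) T by (intro eventually_nhds_in_open) auto
  then show ?thesis
    by (rule eventually_mono) (use assms T in auto)
qed

text \<open>Coordinate lines through a point of \<open>W\<close> stay in \<open>W\<close> nearby, so
  equality on \<open>W\<close> passes to partial derivatives of every order by induction on the
  index list.\<close>

lemma smooth_on_cong:
  assumes W: "openin (Euclidean_space n) W" and f: "smooth_on n W f"
    and eq: "\<And>x. x \<in> W \<Longrightarrow> f x = h x"
  shows "smooth_on n W h"
proof -
  have ev: "eventually (\<lambda>t. f' (x(i := t)) = h' (x(i := t))) (nhds (x i))"
    if "\<forall>x\<in>W. f' x = h' x" "x \<in> W" "i < n" for f' h' :: "(nat \<Rightarrow> real) \<Rightarrow> real" and x i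
    using eventually_fun_upd_in_openin[OF W that(2,3)] by (rule eventually_mono) (use that in auto)
  have *: "\<forall>x\<in>W. foldr partial_deriv is f x = foldr partial_deriv is h x"
    if "is \<in> lists {..<n}" for "is"
    using that
  proof induction
    case (Cons i "is")
    then show ?case
      unfolding partial_deriv_def
      by (auto simp: partial_deriv_def intro!: deriv_cong_ev ev)
  qed (use eq in auto)
  show ?thesis
    unfolding smooth_on_def
  proof (intro ballI conjI allI impI)
    fix "is" assume i: "is \<in> lists {..<n}"
    show "continuous_on W (foldr partial_deriv is h)"
      using f i * by (metis (no_types, lifting) continuous_on_cong smooth_on_def)
    fix j x assume j: "j < n" "x \<in> W"
    obtain D where D: "((\<lambda>t. foldr partial_deriv is f (x(j := t))) has_field_derivative D) (at (x j))"
      using f i j unfolding smooth_on_def field_differentiable_def by blast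
    have "((\<lambda>t. foldr partial_deriv is h (x(j := t))) has_field_derivative D) (at (x j))"
      using DERIV_cong_ev[OF refl ev[OF *[OF i] j(2,1)] refl] D by simp
    then show "(\<lambda>t. foldr partial_deriv is h (x(j := t))) field_differentiable (at (x j))"
      by (auto simp: field_differentiable_def)
  qed
qed

text \<open>A cutoff of the squared distance to \<open>x0\<close>, built from two nested flat
  functions. \<open>K\<close> is a cube rather than a ball because a product of compact sets is
  compact at once.\<close>

lemma Euclidean_space_bump:
  assumes V: "openin (Euclidean_space n) V" and x0: "x0 \<in> V"
  obtains F K W where "F \<in> smooth_terms" "compact K" "K \<subseteq> V"
    "\<And>x. x \<in> topspace (Euclidean_space n) - K \<Longrightarrow> F x = 0"
    "openin (Euclidean_space n) W" "x0 \<in> W" "\<And>x. x \<in> W \<Longrightarrow> F x = 1"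
proof -
  obtain T where T: "open T" "V = {x. \<forall>i\<ge>n. x i = 0} \<inter> T"
    using V by (auto simp: Euclidean_space_eq_top_of_set openin_open)
  then have "openin (product_topology (\<lambda>i::nat. euclidean::real topology) UNIV) T" "x0 \<in> T"
    using x0 by (auto simp: euclidean_product_topology)
  from product_topology_open_contains_basis[OF this] obtain X where
    X: "x0 \<in> (\<Pi>\<^sub>E i\<in>UNIV. X i)" "\<And>i. open (X i)" "(\<Pi>\<^sub>E i\<in>UNIV. X i) \<subseteq> T"
    by auto
  have "\<forall>i. \<exists>e>0. cball (x0 i) e \<subseteq> X i"
    using X by (auto intro!: iffD1[OF open_contains_cball, rule_format])
  then obtain e where e: "\<And>i. e i > 0" "\<And>i. cball (x0 i) (e i) \<subseteq> X i"
    by metis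
  \<comment> \<open>Only the first \<open>n\<close> coordinates vary, so a finite minimum suffices;
    the inserted 1 keeps it defined for \<open>n = 0\<close>.\<close>
  define d where "d = Min (insert 1 (e ` {..<n}))"
  have d: "d > 0" "\<And>i. i < n \<Longrightarrow> d \<le> e i"
    using e by (auto simp: d_def)
  define K where "K = (\<Pi>\<^sub>E i\<in>UNIV. if i < n then cball (x0 i) d else {0})"
  \<comment> \<open>The squared distance, spelled with sums and products so that the constructors of
    \<open>smooth_terms\<close> apply.\<close>
  define s where "s x = (\<Sum>i<n. (x i + - x0 i) * (x i + - x0 i))" for x :: "nat \<Rightarrow> real"
  define c where "c = flat_exp 0 (d\<^sup>2 / 2)"
  \<comment> \<open>The inner \<^term>\<open>flat_exp 0\<close> vanishes for \<open>s x \<le> d\<^sup>2 / 2\<close> and reaches \<open>c\<close> at \<open>s x = d\<^sup>2\<close>.\<close>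
  define F where "F x = inverse (flat_exp 0 c) * flat_exp 0 (c + (- 1) * flat_exp 0 (s x + - (d\<^sup>2 / 2)))" for x
  have "c > 0" using d by (simp add: c_def flat_exp_def)
  then have c: "flat_exp 0 c \<noteq> 0" by (simp add: flat_exp_def)
  have sum_terms: "(\<lambda>x. \<Sum>i<m. (x i + - x0 i) * (x i + - x0 i)) \<in> smooth_terms" for m
    by (induction m) (simp_all only: sum.lessThan_Suc lessThan_0 sum.empty smooth_terms.intros)
  have F: "F \<in> smooth_terms"
    unfolding F_def[abs_def] s_def[abs_def] by (intro smooth_terms.intros sum_terms)
  have "compactin (product_topology (\<lambda>i::nat. euclidean::real topology) UNIV) K"
    unfolding K_def by (subst compactin_PiE) auto
  then have K: "compact K"
    by (simp add: euclidean_product_topology)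
  have KV: "K \<subseteq> V"
  proof
    fix x assume x: "x \<in> K"
    have 0: "x i = 0" if "i \<ge> n" for i
      using x that by (auto simp: K_def PiE_iff dest!: spec[of _ i])
    have "x i \<in> X i" for i
    proof (cases "i < n")
      case True
      then have "x i \<in> cball (x0 i) d" using x by (auto simp: K_def PiE_iff split: if_splits)
      then show ?thesis using d(2)[OF True] e(2)[of i] by auto
    next
      case False
      then have "x i = x0 i" using 0 x0 T by auto
      then show ?thesis using X(1) by (auto simp: PiE_iff)
    qed
    then show "x \<in> V" using X(3) T 0 by (auto simp: PiE_iff)
  qed
  have Fz: "F x = 0" if x: "x \<in> topspace (Euclidean_space n) - K" for x
  proof -
    have 0: "x i = 0" if "i \<ge> n" for i
      using x that by (simp add: topspace_Euclidean_space)
    \<comment> \<open>Outside the cube one coordinate is off by more than \<open>d\<close>, so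
      \<open>s x\<close> is at least \<open>d\<close> squared; the inner flat function is then at
      least \<open>c\<close>, and the outer one gets a nonpositive argument.\<close>
    have "\<exists>i<n. \<bar>x i - x0 i\<bar> > d"
    proof (rule ccontr)
      assume "\<not> ?thesis"
      then have "\<bar>x0 i - x i\<bar> \<le> d" if "i < n" for i
        using that by (metis abs_minus_commute not_less)
      then have "x \<in> K"
        using 0 by (simp add: K_def PiE_iff dist_real_def)
      then show False using x by simp
    qed
    then obtain i where i: "i < n" "\<bar>x i - x0 i\<bar> > d" by blast
    have "d\<^sup>2 \<le> (x i - x0 i)\<^sup>2"
      using i d by (metis abs_le_square_iff abs_of_pos less_imp_le)
    also have "\<dots> \<le> s x"
      using member_le_sum[of i "{..<n}" "\<lambda>i. (x i - x0 i)\<^sup>2"] i by (simp add: s_def power2_eq_square)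
    finally have "d\<^sup>2 / 2 \<le> s x + - (d\<^sup>2 / 2)" by simp
    from flat_exp_mono[OF this] show ?thesis
      by (simp add: F_def c_def flat_exp_def[of _ "_ - _"])
  qed
  \<comment> \<open>On this ball the argument of the inner flat function is negative, so
    \<open>F\<close> reduces to \<open>inverse (flat_exp 0 c) * flat_exp 0 c\<close>.\<close>
  define W where "W = {x. \<forall>i\<ge>n. x i = 0} \<inter> s -` {..<d\<^sup>2 / 2}"
  have "continuous_on UNIV s"
    unfolding s_def[abs_def] by (intro smooth_terms_continuous sum_terms)
  then have "open (s -` {..<d\<^sup>2 / 2})"
    by (simp add: continuous_on_open_vimage)
  then have W: "openin (Euclidean_space n) W"
    by (auto simp: W_def Euclidean_space_eq_top_of_set openin_open)
  have "x0 \<in> W"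
    using x0 T d by (auto simp: W_def s_def)
  moreover have "F x = 1" if "x \<in> W" for x
    using that c by (simp add: W_def F_def flat_exp_def[of _ "s x - _"])
  ultimately show ?thesis
    using that F K KV Fz W by blast
qed

section \<open>Charts and bump functions on the manifold\<close>

lemma openin_chart_image:
  assumes "smooth_manifold M" "(U, \<phi>) \<in> atlas M" "open W" "W \<subseteq> U"
  shows "openin (Euclidean_space (mdim M)) (\<phi> ` W)"
proof -
  have U: "open U" "openin (Euclidean_space (mdim M)) (\<phi> ` U)"
    and h: "homeomorphic_map (top_of_set U) (subtopology (Euclidean_space (mdim M)) (\<phi> ` U)) \<phi>"
    using assms(1,2) by (auto simp: smooth_manifold_def)
  have "openin (top_of_set U) W"
    using assms U by (auto simp: openin_open)
  then have "openin (subtopology (Euclidean_space (mdim M)) (\<phi> ` U)) (\<phi> ` W)"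
    using homeomorphic_imp_open_map[OF h] by (auto simp: open_map_def)
  then show ?thesis
    using U(2) openin_trans_full by blast
qed

lemma chart_inj_on:
  assumes "smooth_manifold M" "(U, \<phi>) \<in> atlas M"
  shows "inj_on \<phi> U"
proof -
  have "open U" "homeomorphic_map (top_of_set U) (subtopology (Euclidean_space (mdim M)) (\<phi> ` U)) \<phi>"
    using assms by (auto simp: smooth_manifold_def)
  then show ?thesis
    by (simp add: homeomorphic_eq_everything_map)
qed

lemma chart_cover:
  assumes "smooth_manifold M"
  obtains U \<phi> where "(U, \<phi>) \<in> atlas M" "p \<in> U" "open U"
proof -
  have "p \<in> (\<Union>(U, \<phi>) \<in> atlas M. U)"
    using assms by (simp add: smooth_manifold_def)
  then obtain U \<phi> where "(U, \<phi>) \<in> atlas M" "p \<in> U" by blast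
  moreover from this have "open U"
    using assms by (auto simp: smooth_manifold_def)
  ultimately show ?thesis by (rule that)
qed

lemma smooth_near_cong:
  assumes M: "smooth_manifold M" and f: "smooth_near M f p"
    and N: "open N" "p \<in> N" and eq: "\<And>q. q \<in> N \<Longrightarrow> f q = h q"
  shows "smooth_near M h p"
proof -
  obtain U \<phi> W where U: "(U, \<phi>) \<in> atlas M" and W: "open W" "p \<in> W" "W \<subseteq> U"
    and s: "smooth_on (mdim M) (\<phi> ` W) (\<lambda>x. f (inv_into U \<phi> x))"
    using f unfolding smooth_near_def by blast
  have "smooth_on (mdim M) (\<phi> ` (W \<inter> N)) (\<lambda>x. h (inv_into U \<phi> x))"
  proof (rule smooth_on_cong)
    show "openin (Euclidean_space (mdim M)) (\<phi> ` (W \<inter> N))"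
      using W N by (intro openin_chart_image[OF M U]) auto
    show "smooth_on (mdim M) (\<phi> ` (W \<inter> N)) (\<lambda>x. f (inv_into U \<phi> x))"
      by (rule smooth_on_subset[OF s]) auto
    fix x assume "x \<in> \<phi> ` (W \<inter> N)"
    then show "f (inv_into U \<phi> x) = h (inv_into U \<phi> x)"
      using chart_inj_on[OF M U] W eq by auto
  qed
  moreover have "open (W \<inter> N)" "p \<in> W \<inter> N" "W \<inter> N \<subseteq> U"
    using W N by auto
  ultimately show ?thesis
    unfolding smooth_near_def using U by blast
qed

lemma smooth_near_const:
  assumes "smooth_manifold M"
  shows "smooth_near M (\<lambda>_. c) p"
proof -
  obtain U \<phi> where "(U, \<phi>) \<in> atlas M" "p \<in> U" "open U"
    using chart_cover[OF assms] .
  moreover have "smooth_on (mdim M) (\<phi> ` U) (\<lambda>_. c)"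
    by (intro smooth_terms_smooth_on smooth_terms.const)
  ultimately show ?thesis
    unfolding smooth_near_def by blast
qed

text \<open>A Euclidean bump is pulled back through a chart and extended by zero. Smoothness is
  recorded for \<open>f q * c\<close> since such products are the coordinates of the sections built
  from \<open>f\<close>.\<close>

lemma smooth_manifold_bump:
  assumes M: "smooth_manifold M" and N: "open N" "p \<in> N"
  obtains f K W where "\<And>c q. smooth_near M (\<lambda>q. f q * c) q" "closed K" "K \<subseteq> N"
    "\<And>q. q \<notin> K \<Longrightarrow> f q = 0" "open W" "p \<in> W" "W \<subseteq> N" "\<And>q. q \<in> W \<Longrightarrow> f q = 1"
proof -
  obtain U \<phi> where U: "(U, \<phi>) \<in> atlas M" "p \<in> U" "open U"
    using chart_cover[OF M] .
  let ?X = "Euclidean_space (mdim M)"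
  have inj: "inj_on \<phi> U" by (rule chart_inj_on[OF M U(1)])
  have oU: "openin ?X (\<phi> ` U)"
    using U by (intro openin_chart_image[OF M]) auto
  have h: "homeomorphic_map (top_of_set U) (subtopology ?X (\<phi> ` U)) \<phi>"
    using M U by (auto simp: smooth_manifold_def)
  then obtain \<psi> where "homeomorphic_maps (top_of_set U) (subtopology ?X (\<phi> ` U)) \<phi> \<psi>"
    by (auto simp: homeomorphic_map_maps)
  then have \<phi>c: "continuous_map (top_of_set U) (subtopology ?X (\<phi> ` U)) \<phi>"
    and \<psi>c: "continuous_map (subtopology ?X (\<phi> ` U)) (top_of_set U) \<psi>"
    and \<psi>: "\<And>q. q \<in> U \<Longrightarrow> \<psi> (\<phi> q) = q"
    by (auto simp: homeomorphic_maps_def)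
  have "openin ?X (\<phi> ` (U \<inter> N))" "\<phi> p \<in> \<phi> ` (U \<inter> N)"
    using U N by (auto intro!: openin_chart_image[OF M])
  then obtain F K V where F: "F \<in> smooth_terms" "\<And>x. x \<in> topspace ?X - K \<Longrightarrow> F x = 0"
    and K: "compact K" "K \<subseteq> \<phi> ` (U \<inter> N)"
    and V: "openin ?X V" "\<phi> p \<in> V" "\<And>x. x \<in> V \<Longrightarrow> F x = 1"
    using Euclidean_space_bump by metis
  define f where "f q = (if q \<in> U then F (\<phi> q) else 0)" for q
  have "compactin (subtopology ?X (\<phi> ` U)) K"
    using K openin_subset[OF oU]
    by (auto simp: compactin_subtopology Euclidean_space_eq_top_of_set topspace_Euclidean_space)
  then have "compactin (top_of_set U) (\<psi> ` K)"
    using \<psi>c image_compactin by blast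
  \<comment> \<open>Here the Hausdorff property enters: a compact set is closed in the whole
    manifold, so \<open>f\<close> is zero on an open set around every point outside the chart
    domain.\<close>
  then have cl: "closed (\<psi> ` K)"
    by (auto simp: compactin_subtopology intro: compact_imp_closed)
  have KN: "\<psi> ` K \<subseteq> U \<inter> N"
    using K \<psi> by auto
  have f0: "f q = 0" if "q \<notin> \<psi> ` K" for q
  proof (cases "q \<in> U")
    case True
    then have "\<phi> q \<notin> K" using that \<psi> by force
    moreover have "\<phi> q \<in> topspace ?X" using openin_subset[OF oU] True by auto
    ultimately show ?thesis using F by (auto simp: f_def)
  qed (simp add: f_def)
  have sm: "smooth_near M (\<lambda>q. f q * c) q" for c q
  proof (cases "q \<in> U")
    case True
    have "smooth_on (mdim M) (\<phi> ` U) (\<lambda>x. f (inv_into U \<phi> x) * c)"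
    proof (rule smooth_on_cong[OF oU])
      show "smooth_on (mdim M) (\<phi> ` U) (\<lambda>x. F x * c)"
        by (intro smooth_terms_smooth_on smooth_terms.intros F)
    qed (auto simp: f_def inj)
    then show ?thesis
      unfolding smooth_near_def using U True by blast
  next
    case False
    show ?thesis
    proof (rule smooth_near_cong[OF M smooth_near_const[OF M, of 0], where N = "- \<psi> ` K"])
      show "open (- \<psi> ` K)" using cl by (simp add: open_Compl)
    qed (use False KN f0 in auto)
  qed
  define W where "W = {q \<in> U. \<phi> q \<in> V} \<inter> N"
  have "openin (top_of_set U) {q \<in> U. \<phi> q \<in> V \<inter> \<phi> ` U}"
    using openin_continuous_map_preimage[OF \<phi>c, of "V \<inter> \<phi> ` U"] V
    by (simp add: openin_subtopology_Int)
  then have "open {q \<in> U. \<phi> q \<in> V \<inter> \<phi> ` U}"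
    using U(3) openin_open_trans by blast
  moreover have "{q \<in> U. \<phi> q \<in> V \<inter> \<phi> ` U} = {q \<in> U. \<phi> q \<in> V}" by auto
  ultimately have "open W"
    using N by (simp add: W_def open_Int)
  then show ?thesis
    using that[of f "\<psi> ` K" W] sm cl KN f0 U N V by (auto simp: W_def f_def)
qed

section \<open>Global frames and sections\<close>

lemma basis_coord_sum:
  assumes "basis_family r b S" "a < r"
  shows "basis_coord r b a (\<Sum>j<r. c j *\<^sub>R b j) = c a"
proof -
  have inj: "inj_on b {..<r}" and ind: "independent (b ` {..<r})"
    using assms by (auto simp: basis_family_def)
  have "representation (b ` {..<r}) (\<Sum>j<r. c j *\<^sub>R b j) (b a)
      = (\<Sum>j<r. c j * representation (b ` {..<r}) (b j) (b a))"
    by (subst real_vector.representation_sum[OF ind])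
      (auto intro!: sum.cong intro: real_vector.span_scale real_vector.span_base
        simp: fun_cong[OF real_vector.representation_scale[OF ind]] real_vector.span_base)
  also have "\<dots> = (\<Sum>j<r. if j = a then c j else 0)"
    using inj assms(2)
    by (intro sum.cong) (auto simp: real_vector.representation_basis[OF ind] inj_on_eq_iff)
  finally show ?thesis
    using assms(2) by (simp add: basis_coord_def)
qed

lemma basis_coord_basis:
  assumes "basis_family r b S" "a < r" "j < r"
  shows "basis_coord r b a (b j) = (if a = j then 1 else 0)"
  using assms by (auto simp: basis_coord_def basis_family_def real_vector.representation_basis inj_on_eq_iff)

lemma basis_family_expand:
  assumes "basis_family r b S" "y \<in> S"
  obtains c where "y = (\<Sum>j<r. c j *\<^sub>R b j)"
proof -
  have "y \<in> span (b ` {..<r})" and inj: "inj_on b {..<r}"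
    using assms by (auto simp: basis_family_def)
  then obtain u where "y = (\<Sum>v\<in>b ` {..<r}. u v *\<^sub>R v)"
    by (auto simp: real_vector.span_finite)
  also have "\<dots> = (\<Sum>j<r. u (b j) *\<^sub>R b j)"
    using inj by (simp add: sum.reindex)
  finally show ?thesis by (rule that)
qed

lemma vector_bundleD:
  assumes "vector_bundle M E"
  shows "subspace (fibre E p)"
    and "(U, X) \<in> trivs E \<Longrightarrow> open U"
    and "(U, X) \<in> trivs E \<Longrightarrow> p \<in> U \<Longrightarrow> basis_family (brank E) (\<lambda>a. X a p) (fibre E p)"
  using assms by (auto simp: vector_bundle_def)

lemma triv_cover:
  assumes "vector_bundle M E"
  obtains U X where "(U, X) \<in> trivs E" "p \<in> U"
proof -
  have "p \<in> (\<Union>(U, X) \<in> trivs E. U)"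
    using assms by (simp add: vector_bundle_def)
  then show ?thesis using that by blast
qed

text \<open>\<open>U\<close> and the complement of \<open>K\<close> are open and cover the manifold.
  Over \<open>U\<close> the coordinates in the frame \<open>X\<close> are \<open>f q * c a\<close>;
  off \<open>K\<close> the section is zero in any trivialisation.\<close>

lemma bump_section:
  assumes M: "smooth_manifold M" and E: "vector_bundle M E" and U: "(U, X) \<in> trivs E"
    and f: "\<And>c q. smooth_near M (\<lambda>q. f q * c) q"
    and K: "closed K" "K \<subseteq> U" "\<And>q. q \<notin> K \<Longrightarrow> f q = 0"
  shows "(\<lambda>q. f q *\<^sub>R (\<Sum>j<brank E. c j *\<^sub>R X j q)) \<in> sections M E" (is "?s \<in> _")
  unfolding sections_def
proof (intro CollectI conjI allI)
  fix q
  show "?s q \<in> fibre E q"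
  proof (cases "q \<in> U")
    case True
    then have "span ((\<lambda>a. X a q) ` {..<brank E}) = fibre E q"
      using vector_bundleD(3)[OF E U] by (auto simp: basis_family_def)
    then show ?thesis
      by (auto intro!: real_vector.span_base real_vector.span_scale real_vector.span_sum)
  next
    \<comment> \<open>Off \<open>U\<close> the values of \<open>X\<close> are unconstrained, but
      \<open>f\<close> vanishes there as \<open>K\<close> lies in \<open>U\<close>.\<close>
    case False
    then have "f q = 0" using K by auto
    then show ?thesis using vector_bundleD(1)[OF E] by (simp add: real_vector.subspace_0)
  qed
  show "\<exists>(V, Y)\<in>trivs E. q \<in> V \<and>
      (\<forall>a<brank E. smooth_near M (\<lambda>q. basis_coord (brank E) (\<lambda>c. Y c q) a (?s q)) q)"
  proof (cases "q \<in> U")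
    case True
    have "smooth_near M (\<lambda>q. basis_coord (brank E) (\<lambda>c. X c q) a (?s q)) q" if "a < brank E" for a
    proof (rule smooth_near_cong[OF M f vector_bundleD(2)[OF E U] True])
      fix x assume "x \<in> U"
      then show "f x * c a = basis_coord (brank E) (\<lambda>c. X c x) a (?s x)"
        using basis_coord_sum[OF vector_bundleD(3)[OF E U] that, of x "\<lambda>j. f x * c j"]
        by (simp add: scaleR_sum_right)
    qed
    then show ?thesis using U True by auto
  next
    case False
    obtain V Y where V: "(V, Y) \<in> trivs E" "q \<in> V"
      using triv_cover[OF E] .
    have "smooth_near M (\<lambda>q. basis_coord (brank E) (\<lambda>c. Y c q) a (?s q)) q" for a
    proof (rule smooth_near_cong[OF M smooth_near_const[OF M, of 0], where N = "- K"])
      fix x assume "x \<in> - K"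
      then show "0 = basis_coord (brank E) (\<lambda>c. Y c x) a (?s x)"
        using K by (simp add: basis_coord_def real_vector.representation_zero)
    qed (use K False in auto)
    then show ?thesis using V by auto
  qed
qed

text \<open>The dual counterpart, with the same covering: over \<open>U\<close> the values on the
  frame are \<open>f\<close> times a Kronecker delta. The conditional implements the convention that
  covectors vanish off the fibre.\<close>

lemma bump_one_form:
  assumes M: "smooth_manifold M" and E: "vector_bundle M E" and U: "(U, X) \<in> trivs E"
    and f: "\<And>c q. smooth_near M (\<lambda>q. f q * c) q"
    and K: "closed K" "K \<subseteq> U" "\<And>q. q \<notin> K \<Longrightarrow> f q = 0" and a: "a < brank E"
  shows "(\<lambda>q x. if x \<in> fibre E q then f q * basis_coord (brank E) (\<lambda>c. X c q) a x else 0)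
      \<in> one_forms M E" (is "?e \<in> _")
  unfolding one_forms_def
proof (intro CollectI conjI allI)
  fix q
  show "linear_fibre_map (fibre E q) (?e q)"
  proof (cases "q \<in> U")
    case True
    then have "independent ((\<lambda>a. X a q) ` {..<brank E})"
      "span ((\<lambda>a. X a q) ` {..<brank E}) = fibre E q"
      using vector_bundleD(3)[OF E U] by (auto simp: basis_family_def)
    then show ?thesis
      using vector_bundleD(1)[OF E, of q]
      by (auto simp: linear_fibre_map_def basis_coord_def algebra_simps
          real_vector.representation_add real_vector.representation_scale
          real_vector.subspace_add real_vector.subspace_scale)
  next
    case False
    then have "f q = 0" using K by auto
    then show ?thesis by (simp add: linear_fibre_map_def)
  qed
  show "\<exists>(V, Y)\<in>trivs E. q \<in> V \<and> (\<forall>b<brank E. smooth_near M (\<lambda>q. ?e q (Y b q)) q)"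
  proof (cases "q \<in> U")
    case True
    have "smooth_near M (\<lambda>q. ?e q (X b q)) q" if b: "b < brank E" for b
    proof (rule smooth_near_cong[OF M f vector_bundleD(2)[OF E U] True])
      fix x assume x: "x \<in> U"
      have "X b x \<in> fibre E x"
        using vector_bundleD(3)[OF E U x] b by (auto simp: basis_family_def intro: real_vector.span_base)
      then show "f x * (if a = b then 1 else 0) = ?e x (X b x)"
        using basis_coord_basis[OF vector_bundleD(3)[OF E U x] a b] by simp
    qed
    then show ?thesis using U True by auto
  next
    case False
    obtain V Y where V: "(V, Y) \<in> trivs E" "q \<in> V"
      using triv_cover[OF E] .
    have "smooth_near M (\<lambda>q. ?e q (Y b q)) q" for b
      by (rule smooth_near_cong[OF M smooth_near_const[OF M, of 0], where N = "- K"])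
        (use K False in auto)
    then show ?thesis using V by auto
  qed
qed simp

text \<open>Frame and dual coframe are cut off by the same bump. Where it equals 1 both are
  unchanged, so duality survives there. This justifies the choice by \<open>SOME\<close> in
  \<open>locality_trace\<close>.\<close>

lemma frame_near_exists:
  assumes M: "smooth_manifold M" and E: "vector_bundle M E"
  shows "\<exists>X e. frame_near M E p X e"
proof -
  obtain U X where U: "(U, X) \<in> trivs E" "p \<in> U"
    using triv_cover[OF E] .
  obtain f K W where f: "\<And>c q. smooth_near M (\<lambda>q. f q * c) q"
    and K: "closed K" "K \<subseteq> U" "\<And>q. q \<notin> K \<Longrightarrow> f q = 0"
    and W: "open W" "p \<in> W" "W \<subseteq> U" "\<And>q. q \<in> W \<Longrightarrow> f q = 1"
    using smooth_manifold_bump[OF M vector_bundleD(2)[OF E U(1)] U(2)] by metis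
  let ?X = "\<lambda>a q. f q *\<^sub>R X a q"
  let ?e = "\<lambda>a q x. if x \<in> fibre E q then f q * basis_coord (brank E) (\<lambda>c. X c q) a x else 0"
  have X: "?X a \<in> sections M E" if "a < brank E" for a
  proof -
    have "(\<Sum>j<brank E. (if j = a then 1 else 0) *\<^sub>R X j q) = X a q" for q
      using that by (simp add: if_distrib[of "\<lambda>c. c *\<^sub>R _"] cong: if_cong)
    then show ?thesis
      using bump_section[OF M E U(1) f K, of "\<lambda>j. if j = a then 1 else 0"] by simp
  qed
  have e: "?e a \<in> one_forms M E" if "a < brank E" for a
    using bump_one_form[OF M E U(1) f K that] .
  have bf: "basis_family (brank E) (\<lambda>a. ?X a q) (fibre E q)" if "q \<in> W" for q
    using that W vector_bundleD(3)[OF E U(1)] by auto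
  have dual: "?e a q (?X b q) = (if a = b then 1 else 0)"
    if "q \<in> W" "a < brank E" "b < brank E" for a b q
  proof -
    have bf: "basis_family (brank E) (\<lambda>a. X a q) (fibre E q)"
      using that W vector_bundleD(3)[OF E U(1)] by auto
    then have "X b q \<in> fibre E q"
      using that by (auto simp: basis_family_def intro: real_vector.span_base)
    then show ?thesis
      using basis_coord_basis[OF bf that(2,3)] W(4)[OF that(1)] by simp
  qed
  have "frame_near M E p ?X ?e"
    unfolding frame_near_def
    by (intro conjI allI impI exI[of _ W] ballI W(1,2)) (fact X e bf dual)+
  then show ?thesis by blast
qed

text \<open>The coordinates of \<open>y\<close> in a local frame are kept constant and multiplied by
  a bump that is 1 at \<open>p\<close>.\<close>

lemma section_through:
  assumes M: "smooth_manifold M" and E: "vector_bundle M E" and y: "y \<in> fibre E p"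
  obtains w where "w \<in> sections M E" "w p = y"
proof -
  obtain U X where U: "(U, X) \<in> trivs E" "p \<in> U"
    using triv_cover[OF E] .
  obtain f K W where f: "\<And>c q. smooth_near M (\<lambda>q. f q * c) q"
    and K: "closed K" "K \<subseteq> U" "\<And>q. q \<notin> K \<Longrightarrow> f q = 0"
    and W: "p \<in> W" "\<And>q. q \<in> W \<Longrightarrow> f q = 1"
    using smooth_manifold_bump[OF M vector_bundleD(2)[OF E U(1)] U(2)] by metis
  obtain c where "y = (\<Sum>j<brank E. c j *\<^sub>R X j p)"
    using basis_family_expand[OF vector_bundleD(3)[OF E U] y] .
  then show ?thesis
    using that[OF bump_section[OF M E U(1) f K, of c]] W by simp
qed

text \<open>The frame picked by \<open>SOME\<close> is a genuine one, so each summand is the value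
  at \<open>p\<close> of a global section, and fibres are closed under sums.\<close>

lemma locality_trace_in_fibre:
  assumes M: "smooth_manifold M" and E: "vector_bundle M E" and L: "smooth_multilinear M E L"
    and nabla: "real_bilinear_on_sections M E nabla"
    and u: "u \<in> sections M E" and v: "v \<in> sections M E"
  shows "locality_trace M E L nabla u v p \<in> fibre E p"
proof -
  obtain X e where Xe: "(SOME (X, e). frame_near M E p X e) = (X, e)"
    by fastforce
  have "\<exists>z. case z of (X, e) \<Rightarrow> frame_near M E p X e"
    using frame_near_exists[OF M E] by auto
  from someI_ex[OF this] have "frame_near M E p X e"
    by (simp add: Xe)
  then have "L (e a) (nabla (X a) u) v \<in> sections M E" if "a < brank E" for a
    using that L nabla u v
    by (simp add: frame_near_def smooth_multilinear_def real_bilinear_on_sections_def)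
  then have "L (e a) (nabla (X a) u) v p \<in> fibre E p" if "a < brank E" for a
    using that by (auto simp: sections_def)
  then show ?thesis
    by (auto simp: locality_trace_def Xe intro!: real_vector.subspace_sum vector_bundleD(1)[OF E])
qed

section \<open>Levi-Civita and Koszul connections\<close>

theorem proposition3p13:
  fixes M :: "('m :: {t2_space, second_countable_topology}) manifold"
    and E :: "('m, 'v :: real_vector) vbundle"
    and \<rho> :: "'m \<Rightarrow> 'v \<Rightarrow> ('m \<Rightarrow> real) \<Rightarrow> real"
    and br :: "('m \<Rightarrow> 'v) \<Rightarrow> ('m \<Rightarrow> 'v) \<Rightarrow> 'm \<Rightarrow> 'v"
    and L :: "('m \<Rightarrow> 'v \<Rightarrow> real) \<Rightarrow> ('m \<Rightarrow> 'v) \<Rightarrow> ('m \<Rightarrow> 'v) \<Rightarrow> 'm \<Rightarrow> 'v"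
    and g :: "'m \<Rightarrow> 'v \<Rightarrow> 'v \<Rightarrow> real"
    and nabla :: "('m \<Rightarrow> 'v) \<Rightarrow> ('m \<Rightarrow> 'v) \<Rightarrow> 'm \<Rightarrow> 'v"
  assumes "smooth_manifold M"
    and "local_almost_Leibniz_algebroid M E \<rho> br L"
    and "E_metric M E g"
    and "linear_E_connection M E \<rho> nabla"
  shows "E_Levi_Civita M E \<rho> br L g nabla \<longleftrightarrow>
           admissible M E br L nabla \<and> E_Koszul M E \<rho> br L g nabla"
proof -
  let ?S = "sections M E"
  let ?B = "modified_bracket M E br L nabla"
  let ?R = "\<lambda>u v w. anchor_act \<rho> u (\<lambda>q. g q (v q) (w q))"
  have E: "vector_bundle M E" and br: "real_bilinear_on_sections M E br"
    and L: "smooth_multilinear M E L"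
    using assms(2) by (auto simp: local_almost_Leibniz_algebroid_def
        almost_Leibniz_algebroid_def anchored_vector_bundle_def)
  have nb: "real_bilinear_on_sections M E nabla"
    using assms(4) by (simp add: linear_E_connection_def)
  note sub = vector_bundleD(1)[OF E]
  have sec: "u p \<in> fibre E p" if "u \<in> ?S" for u p
    using that by (simp add: sections_def)
  have nab: "nabla u v p \<in> fibre E p" if "u \<in> ?S" "v \<in> ?S" for u v p
    using that nb sec by (simp add: real_bilinear_on_sections_def)
  have B: "?B u v p \<in> fibre E p" if "u \<in> ?S" "v \<in> ?S" for u v p
    using that br sec locality_trace_in_fibre[OF assms(1) E L nb that]
    by (simp add: modified_bracket_def real_bilinear_on_sections_def real_vector.subspace_diff[OF sub])
  have g_sym: "g p x y = g p y x" if "x \<in> fibre E p" "y \<in> fibre E p" for p x y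
    using that assms(3) by (simp add: E_metric_def)
  \<comment> \<open>\<open>E_metric\<close> states linearity in the second argument; symmetry moves
    it to the first, which requires sums and multiples to remain in the fibre.\<close>
  have g_add: "g p (x + y) z = g p x z + g p y z"
    and g_scale: "g p (c *\<^sub>R x) z = c * g p x z"
    if "x \<in> fibre E p" "y \<in> fibre E p" "z \<in> fibre E p" for p x y z c
    using that assms(3) g_sym real_vector.subspace_add[OF sub] real_vector.subspace_scale[OF sub]
    by (simp_all add: E_metric_def linear_fibre_map_def)
  have g_minus: "g p (- x) z = - g p x z" if "x \<in> fibre E p" "z \<in> fibre E p" for p x z
    using g_scale[of x p x z "-1"] that by simp
  have g_diff: "g p (x - y) z = g p x z - g p y z"
    if "x \<in> fibre E p" "y \<in> fibre E p" "z \<in> fibre E p" for p x y z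
    using g_add[of x p "- y" z] g_minus[of y p z] that real_vector.subspace_neg[OF sub] by simp
  \<comment> \<open>Symmetry of \<open>g\<close> holds at every point, so both sides differentiate
    the same function.\<close>
  have R_sym: "?R u v w = ?R u w v" if "v \<in> ?S" "w \<in> ?S" for u v w
    using that by (simp add: g_sym sec)
  \<comment> \<open>Moving the traces to the left turns admissibility into antisymmetry of the
    modified bracket, the form used in both directions.\<close>
  have adm: "admissible M E br L nabla \<longleftrightarrow> (\<forall>u\<in>?S. \<forall>v\<in>?S. \<forall>p. ?B u v p = - ?B v u p)"
    unfolding admissible_def modified_bracket_def by (simp add: algebra_simps)
  show ?thesis
  proof
    assume LC: "E_Levi_Civita M E \<rho> br L g nabla"
    have T: "?B u v p = nabla u v p - nabla v u p" if "u \<in> ?S" "v \<in> ?S" for u v p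
    proof -
      have "E_torsion M E br L nabla u v p = 0"
        using LC that by (simp add: E_Levi_Civita_def)
      then show ?thesis by (simp add: E_torsion_def)
    qed
    have Q: "?R u v w p = g p (nabla u v p) (w p) + g p (nabla u w p) (v p)"
      if "u \<in> ?S" "v \<in> ?S" "w \<in> ?S" for u v w p
    proof -
      have "E_nonmetricity \<rho> nabla g u v w p = 0"
        using LC that by (simp add: E_Levi_Civita_def)
      then show ?thesis
        using g_sym[OF sec[OF that(2)] nab[OF that(1,3)]] by (simp add: E_nonmetricity_def)
    qed
    have "admissible M E br L nabla"
      unfolding adm by (simp add: T)
    \<comment> \<open>Metricity expands the derivative terms into six products and zero torsion
      expands the bracket terms into six more; all cancel except two copies of
      \<open>g p (nabla u v p) (w p)\<close>.\<close>
    moreover have "E_Koszul M E \<rho> br L g nabla"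
      unfolding E_Koszul_def by (simp add: T Q g_diff nab sec)
    ultimately show "admissible M E br L nabla \<and> E_Koszul M E \<rho> br L g nabla" ..
  next
    assume AK: "admissible M E br L nabla \<and> E_Koszul M E \<rho> br L g nabla"
    have A: "?B u v p = - ?B v u p" if "u \<in> ?S" "v \<in> ?S" for u v p
      using AK that unfolding adm by blast
    have Ko: "2 * g p (nabla u v p) (w p) = ?R u v w p + ?R v u w p - ?R w u v p
          - g p (?B v w p) (u p) - g p (?B u w p) (v p) + g p (?B u v p) (w p)"
        if "u \<in> ?S" "v \<in> ?S" "w \<in> ?S" for u v w p
      using AK that by (simp add: E_Koszul_def)
    have gA: "g p (?B u v p) (w p) = - g p (?B v u p) (w p)"
      if "u \<in> ?S" "v \<in> ?S" "w \<in> ?S" for u v w p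
      using A[OF that(1,2), of p] g_minus[OF B[OF that(2,1)] sec[OF that(3)]] by simp
    have "E_torsion M E br L nabla u v p = 0" if u: "u \<in> ?S" and v: "v \<in> ?S" for u v p
    proof -
      let ?t = "E_torsion M E br L nabla u v p"
      have t: "?t \<in> fibre E p"
        using u v by (simp add: E_torsion_def nab B real_vector.subspace_diff[OF sub])
      have "g p ?t y = 0" if y: "y \<in> fibre E p" for y
      proof -
        \<comment> \<open>The Koszul formula tests only against sections, so \<open>y\<close> is
          extended to one before non-degeneracy can be used.\<close>
        obtain w where w: "w \<in> ?S" "w p = y"
          using section_through[OF assms(1) E y] .
        \<comment> \<open>The Koszul formulas for \<open>u, v\<close> and \<open>v, u\<close> are
          subtracted: the derivative terms and the brackets with \<open>w\<close> cancel, and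
          antisymmetry doubles the remaining bracket.\<close>
        have "2 * g p (nabla u v p) (w p) - 2 * g p (nabla v u p) (w p) = 2 * g p (?B u v p) (w p)"
          using Ko[OF u v w(1), of p] Ko[OF v u w(1), of p] gA[OF u v w(1), of p] R_sym[OF u v, of w]
          by simp
        then have "g p ?t (w p) = 0"
          using u v w(1) by (simp add: E_torsion_def g_diff nab B sec real_vector.subspace_diff[OF sub])
        then show ?thesis using w by simp
      qed
      then show ?thesis
        using t assms(3) by (simp add: E_metric_def)
    qed
    \<comment> \<open>The Koszul formulas for \<open>u, v, w\<close> and \<open>u, w, v\<close> are
      added: the derivative along \<open>u\<close> survives twice, and the brackets of
      \<open>v\<close> and \<open>w\<close> cancel by antisymmetry.\<close>
    moreover have "E_nonmetricity \<rho> nabla g u v w p = 0"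
      if u: "u \<in> ?S" and v: "v \<in> ?S" and w: "w \<in> ?S" for u v w p
      using Ko[OF u v w, of p] Ko[OF u w v, of p] gA[OF v w u, of p] R_sym[OF v w, of u]
        g_sym[OF sec[OF v] nab[OF u w]] by (simp add: E_nonmetricity_def)
    ultimately show "E_Levi_Civita M E \<rho> br L g nabla"
      by (simp add: E_Levi_Civita_def fun_eq_iff)
  qed
qed

end
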